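(* Let $(A,\cdot,\alpha)$ be a Hom-associative algebra and let $(V,l,r,\beta)$ be a bimodule of $A$. A linear map $\mathcal K:V\to A$ is a relative averaging operator on $(A,\cdot,\alpha)$ with respect to $(V,l,r,\beta)$ if and only if the graph $Gr(\mathcal K)=\{\mathcal K u+u \mid u\in V\}$ is a subalgebra of the hemisemi-direct product Hom-associative dialgebra $A\oplus_{Diass}V$.
   Context: All vector spaces are over a field $\mathbb K$ of characteristic $0$. All Hom-algebras are multiplicative, i.e. the twisting map preserves every bilinear operation of the structure. A Hom-associative algebra $(A,\cdot,\alpha)$ is a vector space $A$ with a bilinear operation $\cdot$ and a linear map $\alpha:A\to A$ such that $(x\cdot y)\cdot\alpha(z)=\alpha(x)\cdot(y\cdot z)$ for all $x,y,z\in A$. A bimodule $(V,l,r,\beta)$ of $(A,\cdot,\alpha)$ is a vector space $V$ with a linear map $\beta:V\to V$ and linear maps $l,r:A\to \mathrm{End}(V)$ such that for all $x,y\in A$: $\beta l(x)=l(\alpha(x))\beta$, $\beta r(x)=r(\alpha(x))\beta$, $l(x\cdot y)\beta=l(\alpha(x))l(y)$, $r(x\cdot y)\beta=r(\alpha(y))r(x)$, $l(\alpha(x))r(y)=r(\alpha(y))l(x)$. A linear map $\mathcal K:V\to A$ is a relative averaging operator on $A$ with respect to $(V,l,r,\beta)$ if $\mathcal K\beta=\alpha\mathcal K$ and $\mathcal K(u)\cdot\mathcal K(v)=\mathcal K(l(\mathcal K(u))v)=\mathcal K(r(\mathcal K(v))u)$ for all $u,v\in V$. The hemisemi-direct product $A\oplus_{Diass}V$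 is the Hom-associative dialgebra on $A\oplus V$ with, for $x,y\in A$, $u,v\in V$: $(x+u)\vdash_{A\oplus V}(y+v)=x\cdot y+l(x)v$, $(x+u)\dashv_{A\oplus V}(y+v)=x\cdot y+r(y)u$, and twisting map $\alpha_{A\oplus V}(x+u)=\alpha(x)+\beta(u)$. A subalgebra of it is a linear subspace closed under both products and under the twisting map. *)

theory Defs
  imports "HOL-Analysis.Product_Vector"
begin

text \<open>
  A vector space is a type of class \<open>ab_group_add\<close> with an explicit scalar multiplication
  \<open>'k \<Rightarrow> 'a \<Rightarrow> 'a\<close> over a field \<open>'k\<close> of characteristic 0, in the sense of the library
  locale \<open>vector_space\<close>.
\<close>

definition bilinear_map ::
  "('k::field_char_0 \<Rightarrow> 'a::ab_group_add \<Rightarrow> 'a) \<Rightarrow> ('k \<Rightarrow> 'b::ab_group_add \<Rightarrow> 'b) \<Rightarrow>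
   ('k \<Rightarrow> 'c::ab_group_add \<Rightarrow> 'c) \<Rightarrow> ('a \<Rightarrow> 'b \<Rightarrow> 'c) \<Rightarrow> bool"
  where "bilinear_map s1 s2 s3 f \<longleftrightarrow>
    (\<forall>x. Vector_Spaces.linear s2 s3 (f x)) \<and> (\<forall>y. Vector_Spaces.linear s1 s3 (\<lambda>x. f x y))"

text \<open>Hom-algebras are multiplicative by convention; no unit is required.\<close>

locale hom_assoc_algebra = vector_space scA
  for scA :: "'k::field_char_0 \<Rightarrow> 'a::ab_group_add \<Rightarrow> 'a" +
  fixes mult :: "'a \<Rightarrow> 'a \<Rightarrow> 'a" (infixl \<open>\<cdot>\<close> 70)
    and \<alpha> :: "'a \<Rightarrow> 'a"
  assumes mult_bilinear: "bilinear_map scA scA scA mult"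
    and twist_linear: "Vector_Spaces.linear scA scA \<alpha>"
    and twist_mult: "\<alpha> (x \<cdot> y) = \<alpha> x \<cdot> \<alpha> y"
    and hom_assoc: "(x \<cdot> y) \<cdot> \<alpha> z = \<alpha> x \<cdot> (y \<cdot> z)"

text \<open>
  A linear map \<open>A \<rightarrow> End(V)\<close> is encoded as its uncurried action \<open>'a \<Rightarrow> 'v \<Rightarrow> 'v\<close>, which is
  bilinear. In particular \<open>r x u\<close> is \<open>r(x)u\<close>, with the algebra element as first argument.
\<close>

locale hom_bimodule = A: hom_assoc_algebra scA mult \<alpha> + V: vector_space scV
  for scA :: "'k::field_char_0 \<Rightarrow> 'a::ab_group_add \<Rightarrow> 'a"
    and mult :: "'a \<Rightarrow> 'a \<Rightarrow> 'a" (infixl \<open>\<cdot>\<close> 70)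
    and \<alpha> :: "'a \<Rightarrow> 'a"
    and scV :: "'k \<Rightarrow> 'v::ab_group_add \<Rightarrow> 'v" +
  fixes l r :: "'a \<Rightarrow> 'v \<Rightarrow> 'v"
    and \<beta> :: "'v \<Rightarrow> 'v"
  assumes twistV_linear: "Vector_Spaces.linear scV scV \<beta>"
    and l_bilinear: "bilinear_map scA scV scV l"
    and r_bilinear: "bilinear_map scA scV scV r"
    and twist_l: "\<beta> (l x v) = l (\<alpha> x) (\<beta> v)"
    and twist_r: "\<beta> (r x v) = r (\<alpha> x) (\<beta> v)"
    and l_mult: "l (x \<cdot> y) (\<beta> v) = l (\<alpha> x) (l y v)"
    and r_mult: "r (x \<cdot> y) (\<beta> v) = r (\<alpha> y) (r x v)"
    and l_r_commute: "l (\<alpha> x) (r y v) = r (\<alpha> y) (l x v)"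

definition relative_averaging_operator ::
  "('k::field_char_0 \<Rightarrow> 'a::ab_group_add \<Rightarrow> 'a) \<Rightarrow> ('a \<Rightarrow> 'a \<Rightarrow> 'a) \<Rightarrow> ('a \<Rightarrow> 'a) \<Rightarrow>
   ('k \<Rightarrow> 'v::ab_group_add \<Rightarrow> 'v) \<Rightarrow> ('a \<Rightarrow> 'v \<Rightarrow> 'v) \<Rightarrow> ('a \<Rightarrow> 'v \<Rightarrow> 'v) \<Rightarrow> ('v \<Rightarrow> 'v) \<Rightarrow>
   ('v \<Rightarrow> 'a) \<Rightarrow> bool"
  where "relative_averaging_operator scA mult \<alpha> scV l r \<beta> K \<longleftrightarrow>
    Vector_Spaces.linear scV scA K \<and>
    (\<forall>u. K (\<beta> u) = \<alpha> (K u)) \<and>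
    (\<forall>u v. mult (K u) (K v) = K (l (K u) v) \<and> K (l (K u) v) = K (r (K v) u))"

text \<open>
  Hom-associative dialgebras: the twisted form of Loday's five associative dialgebra axioms,
  with multiplicative twist. \<open>lp\<close> is \<open>\<stileturn>\<close> and \<open>rp\<close> is \<open>\<turnstile>\<close>.
\<close>

locale hom_assoc_dialgebra = vector_space scD
  for scD :: "'k::field_char_0 \<Rightarrow> 'd::ab_group_add \<Rightarrow> 'd" +
  fixes lp :: "'d \<Rightarrow> 'd \<Rightarrow> 'd" (infixl \<open>\<stileturn>\<close> 70)
    and rp :: "'d \<Rightarrow> 'd \<Rightarrow> 'd" (infixl \<open>\<turnstile>\<close> 70)
    and \<alpha> :: "'d \<Rightarrow> 'd"
  assumes lp_bilinear: "bilinear_map scD scD scD lp"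
    and rp_bilinear: "bilinear_map scD scD scD rp"
    and twist_linear: "Vector_Spaces.linear scD scD \<alpha>"
    and twist_lp: "\<alpha> (x \<stileturn> y) = \<alpha> x \<stileturn> \<alpha> y"
    and twist_rp: "\<alpha> (x \<turnstile> y) = \<alpha> x \<turnstile> \<alpha> y"
    and lp_lp: "(x \<stileturn> y) \<stileturn> \<alpha> z = \<alpha> x \<stileturn> (y \<stileturn> z)"
    and lp_bar: "\<alpha> x \<stileturn> (y \<stileturn> z) = \<alpha> x \<stileturn> (y \<turnstile> z)"
    and rp_lp: "(x \<turnstile> y) \<stileturn> \<alpha> z = \<alpha> x \<turnstile> (y \<stileturn> z)"
    and rp_bar: "(x \<stileturn> y) \<turnstile> \<alpha> z = (x \<turnstile> y) \<turnstile> \<alpha> z"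
    and rp_rp: "(x \<turnstile> y) \<turnstile> \<alpha> z = \<alpha> x \<turnstile> (y \<turnstile> z)"
begin

definition subalgebra :: "'d set \<Rightarrow> bool"
  where "subalgebra S \<longleftrightarrow> subspace S \<and>
    (\<forall>x\<in>S. \<forall>y\<in>S. x \<stileturn> y \<in> S) \<and> (\<forall>x\<in>S. \<forall>y\<in>S. x \<turnstile> y \<in> S) \<and> (\<forall>x\<in>S. \<alpha> x \<in> S)"

end

text \<open>
  The hemisemi-direct product lives on \<open>'a \<times> 'v\<close>, where \<open>(x, u)\<close> stands for \<open>x + u\<close>; its
  scalar multiplication is the library's \<open>module_prod.scale scA scV\<close>.
\<close>

definition hsd_lp ::
  "('a \<Rightarrow> 'a \<Rightarrow> 'a) \<Rightarrow> ('a \<Rightarrow> 'v \<Rightarrow> 'v) \<Rightarrow> 'a \<times> 'v \<Rightarrow> 'a \<times> 'v \<Rightarrow> 'a \<times> 'v"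
  where "hsd_lp mult r = (\<lambda>(x, u) (y, v). (mult x y, r y u))"

definition hsd_rp ::
  "('a \<Rightarrow> 'a \<Rightarrow> 'a) \<Rightarrow> ('a \<Rightarrow> 'v \<Rightarrow> 'v) \<Rightarrow> 'a \<times> 'v \<Rightarrow> 'a \<times> 'v \<Rightarrow> 'a \<times> 'v"
  where "hsd_rp mult l = (\<lambda>(x, u) (y, v). (mult x y, l x v))"

definition hsd_twist :: "('a \<Rightarrow> 'a) \<Rightarrow> ('v \<Rightarrow> 'v) \<Rightarrow> 'a \<times> 'v \<Rightarrow> 'a \<times> 'v"
  where "hsd_twist \<alpha> \<beta> = (\<lambda>(x, u). (\<alpha> x, \<beta> u))"

definition graph_of :: "('v \<Rightarrow> 'a) \<Rightarrow> ('a \<times> 'v) set"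
  where "graph_of K = {(K u, u) | u. True}"

lemma (in hom_bimodule) hemisemidirect_product:
  "hom_assoc_dialgebra (module_prod.scale scA scV) (hsd_lp mult r) (hsd_rp mult l) (hsd_twist \<alpha> \<beta>)"
proof -
  interpret vector_space_prod scA scV ..
  note lin = linear_iff_module_hom module_hom_iff
  note bil = A.mult_bilinear l_bilinear r_bilinear A.twist_linear twistV_linear
  show ?thesis
    by unfold_locales
      (use bil in \<open>auto simp: bilinear_map_def lin p.module_axioms scale_def
        hsd_lp_def hsd_rp_def hsd_twist_def A.twist_mult A.hom_assoc
        twist_l twist_r l_mult r_mult l_r_commute\<close>)
qed

end

theory Submission
  imports Defs
begin

text \<open>
  A pair lies in the graph of \<open>K\<close> iff its first component is the image under \<open>K\<close> of its
  second. Both products and the twist of the hemisemi-direct product restrict to \<open>mult\<close> and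
  \<open>\<alpha>\<close> on the first component, and act by \<open>r\<close>, \<open>l\<close> and \<open>\<beta>\<close> on the second. So closure of the graph
  under \<open>\<stileturn>\<close>, \<open>\<turnstile>\<close> and the twist says respectively that, for all \<open>u\<close> and \<open>v\<close>,
  \<open>mult (K u) (K v) = K (r (K v) u)\<close>, \<open>mult (K u) (K v) = K (l (K u) v)\<close> and
  \<open>\<alpha> (K u) = K (\<beta> u)\<close>: exactly the identities of a relative averaging operator. The remaining
  requirement, that the graph is a subspace, is the linearity of \<open>K\<close>.
\<close>

lemma mem_graph_of_iff: "(x, u) \<in> graph_of K \<longleftrightarrow> x = K u"
  by (auto simp: graph_of_def)

lemma ball_graph_of: "(\<forall>p\<in>graph_of K. P p) \<longleftrightarrow> (\<forall>u. P (K u, u))"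
  by (auto simp: graph_of_def)

lemma subspace_graph_of:
  assumes "Vector_Spaces.linear s1 s2 K"
  shows "module.subspace (module_prod.scale s2 s1) (graph_of K)"
proof -
  interpret K: Vector_Spaces.linear s1 s2 K by fact
  interpret vector_space_prod s2 s1 ..
  show ?thesis
    by (auto simp: p.subspace_def graph_of_def scale_def zero_prod_def K.zero K.add K.scale)
qed

theorem theorem3p6:
  fixes scA :: "'k::field_char_0 \<Rightarrow> 'a::ab_group_add \<Rightarrow> 'a"
    and mult :: "'a \<Rightarrow> 'a \<Rightarrow> 'a"
    and \<alpha> :: "'a \<Rightarrow> 'a"
    and scV :: "'k \<Rightarrow> 'v::ab_group_add \<Rightarrow> 'v"
    and l r :: "'a \<Rightarrow> 'v \<Rightarrow> 'v"
    and \<beta> :: "'v \<Rightarrow> 'v"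
    and K :: "'v \<Rightarrow> 'a"
  assumes "hom_assoc_algebra scA mult \<alpha>"
    and "hom_bimodule scA mult \<alpha> scV l r \<beta>"
    and "Vector_Spaces.linear scV scA K"
  shows "relative_averaging_operator scA mult \<alpha> scV l r \<beta> K \<longleftrightarrow>
    hom_assoc_dialgebra.subalgebra (module_prod.scale scA scV)
      (hsd_lp mult r) (hsd_rp mult l) (hsd_twist \<alpha> \<beta>) (graph_of K)"
proof -
  interpret hom_bimodule scA mult \<alpha> scV l r \<beta> by fact
  interpret D: hom_assoc_dialgebra "module_prod.scale scA scV"
    "hsd_lp mult r" "hsd_rp mult l" "hsd_twist \<alpha> \<beta>"
    by (rule hemisemidirect_product)
  have "D.subalgebra (graph_of K) \<longleftrightarrow>
      (\<forall>u v. mult (K u) (K v) = K (r (K v) u)) \<and>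
      (\<forall>u v. mult (K u) (K v) = K (l (K u) v)) \<and>
      (\<forall>u. \<alpha> (K u) = K (\<beta> u))"
    using subspace_graph_of[OF assms(3)]
    unfolding D.subalgebra_def
    by (simp add: ball_graph_of mem_graph_of_iff hsd_lp_def hsd_rp_def hsd_twist_def)
  then show ?thesis
    using assms(3) by (auto simp: relative_averaging_operator_def)
qed

end
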